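(* Let $\Gamma$ be a countable directed graph, $F:\Gamma_{Ar}\to\mathbb R$ a potential and $\beta\in\mathbb R$. There is a bijection $m\mapsto\psi$ between the set of $e^{\beta F}$-conformal measures $m$ on $P(\Gamma)$ and the $A(\beta)$-harmonic vectors $\psi$, given by $$\psi_v=m(Z(v)),\quad v\in\Gamma_V.$$
   Context: A countable directed graph $\Gamma$ consists of countable sets $\Gamma_V$ (vertices) and $\Gamma_{Ar}$ (arrows) with source and range maps $s,r:\Gamma_{Ar}\to\Gamma_V$ (multiple arrows, loops, sinks and vertices emitting infinitely many arrows are allowed). $P(\Gamma)$ is the set of infinite paths $p=(p_i)_{i\ge1}\in(\Gamma_{Ar})^{\mathbb N}$, $r(p_i)=s(p_{i+1})$, with the topology inherited from the product of discrete spaces; $Z(v)=\{p:s(p_1)=v\}$ for a vertex $v$, $Z(a)=\{p:p_1=a\}$ for an arrow $a$; the shift is $\sigma(p)_i=p_{i+1}$. A non-zero Borel measure $m$ on $P(\Gamma)$ with $m(Z(v))<\infty$ for all $v\in\Gamma_V$ is $e^{\beta F}$-conformal if $m(\sigma(B\cap Z(a)))=e^{\beta F(a)}m(B\cap Z(a))$ for all arrows $a$ and Borel sets $B\subseteq P(\Gamma)$. $A(\beta)_{v,w}=\sum_{a\in s^{-1}(v)\cap r^{-1}(w)}e^{-\beta F(a)}\in[0,\infty]$. A non-zero vector $\psi=(\psi_v)_{v\in\Gamma_V}\in[0,\infty)^{\Gamma_V}$ is $A(\beta)$-harmonic if $\sum_{w\in\Gamma_V}A(\beta)_{v,w}\psi_w=\psi_v$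 for all $v\in\Gamma_V$ (with $\infty\cdot0=0$). *)

theory Defs
  imports "HOL-Analysis.Analysis" "Graph_Theory.Digraph"
begin

text \<open>
  Source and range of an arrow are \<^term>\<open>tail G\<close> and \<^term>\<open>head G\<close>.
  Paths are indexed from \<open>0\<close>, so \<open>p i\<close> is the arrow usually written $p_{i+1}$.
\<close>

definition inf_paths :: "('v, 'a) pre_digraph \<Rightarrow> (nat \<Rightarrow> 'a) set" where
  "inf_paths G = {p. \<forall>i. p i \<in> arcs G \<and> head G (p i) = tail G (p (Suc i))}"

definition path_topology :: "('v, 'a) pre_digraph \<Rightarrow> (nat \<Rightarrow> 'a) topology" where
  "path_topology G =
    subtopology (product_topology (\<lambda>_. discrete_topology (arcs G)) UNIV) (inf_paths G)"

text \<open>Only the space and the \<open>\<sigma>\<close>-algebra of this (zero) measure are used.\<close>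

definition path_borel :: "('v, 'a) pre_digraph \<Rightarrow> (nat \<Rightarrow> 'a) measure" where
  "path_borel G = sigma (inf_paths G) {U. openin (path_topology G) U}"

definition vertex_cyl :: "('v, 'a) pre_digraph \<Rightarrow> 'v \<Rightarrow> (nat \<Rightarrow> 'a) set" where
  "vertex_cyl G v = {p \<in> inf_paths G. tail G (p 0) = v}"

definition arrow_cyl :: "('v, 'a) pre_digraph \<Rightarrow> 'a \<Rightarrow> (nat \<Rightarrow> 'a) set" where
  "arrow_cyl G a = {p \<in> inf_paths G. p 0 = a}"

definition path_shift :: "(nat \<Rightarrow> 'a) \<Rightarrow> (nat \<Rightarrow> 'a)" where
  "path_shift p = (\<lambda>i. p (Suc i))"

text \<open>
  The sets \<^term>\<open>path_shift ` (B \<inter> arrow_cyl G a)\<close> below are Borel, because the shift restricts to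
  a homeomorphism of \<^term>\<open>arrow_cyl G a\<close> onto \<^term>\<open>vertex_cyl G (head G a)\<close>; so \<^const>\<open>emeasure\<close>
  is never applied outside the \<open>\<sigma>\<close>-algebra.
\<close>

definition conformal_measure ::
  "('v, 'a) pre_digraph \<Rightarrow> ('a \<Rightarrow> real) \<Rightarrow> real \<Rightarrow> (nat \<Rightarrow> 'a) measure \<Rightarrow> bool" where
  "conformal_measure G F \<beta> m \<longleftrightarrow>
     sets m = sets (path_borel G) \<and>
     emeasure m (inf_paths G) \<noteq> 0 \<and>
     (\<forall>v\<in>verts G. emeasure m (vertex_cyl G v) < \<infinity>) \<and>
     (\<forall>a\<in>arcs G. \<forall>B\<in>sets (path_borel G).
        emeasure m (path_shift ` (B \<inter> arrow_cyl G a)) =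
        ennreal (exp (\<beta> * F a)) * emeasure m (B \<inter> arrow_cyl G a))"

text \<open>
  Sums are taken in \<^typ>\<open>ennreal\<close>, where every family is summable and \<open>\<infinity> * 0 = 0\<close>.
\<close>

definition adj_matrix ::
  "('v, 'a) pre_digraph \<Rightarrow> ('a \<Rightarrow> real) \<Rightarrow> real \<Rightarrow> 'v \<Rightarrow> 'v \<Rightarrow> ennreal" where
  "adj_matrix G F \<beta> v w =
     (\<Sum>\<^sub>\<infinity>a\<in>{a \<in> arcs G. tail G a = v \<and> head G a = w}. ennreal (exp (- \<beta> * F a)))"

text \<open>
  Vectors indexed by the vertices are functions extensional on \<^term>\<open>verts G\<close>, so that equality of
  functions is equality of vectors.
\<close>

definition harmonic_vector ::
  "('v, 'a) pre_digraph \<Rightarrow> ('a \<Rightarrow> real) \<Rightarrow> real \<Rightarrow> ('v \<Rightarrow> real) \<Rightarrow> bool" where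
  "harmonic_vector G F \<beta> \<psi> \<longleftrightarrow>
     \<psi> \<in> verts G \<rightarrow>\<^sub>E {0..} \<and>
     (\<exists>v\<in>verts G. \<psi> v \<noteq> 0) \<and>
     (\<forall>v\<in>verts G. (\<Sum>\<^sub>\<infinity>w\<in>verts G. adj_matrix G F \<beta> v w * ennreal (\<psi> w)) = ennreal (\<psi> v))"

end

theory Submission
  imports Defs "HOL-Probability.Probability"
begin

text \<open>
  For a vertex \<open>v\<close> and a finite list \<open>xs\<close> of arrows, let \<open>cyl G v xs\<close> be the set of paths that
  start at \<open>v\<close> and begin with \<open>xs\<close>. The shift maps \<open>cyl G v (a # xs)\<close> bijectively onto
  \<open>cyl G (head G a) xs\<close> when \<open>a\<close> is emitted by \<open>v\<close>, so conformality forces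
  \<open>m (cyl G v (a # xs)) = exp (- \<beta> F(a)) * m (cyl G (head G a) xs)\<close>. By induction on \<open>xs\<close> the
  values of a conformal measure on all cylinders are therefore determined by the values
  \<open>\<psi>\<^sub>v = m (Z(v))\<close>; they are the weights defined below (\<open>conformal_measure_cyl\<close>). The cylinders form
  a \<open>\<pi>\<close>-system that generates the Borel sets (\<open>sets_path_borel\<close>), and countably many of them, of
  finite measure, cover the path space. Hence \<open>\<psi>\<close> determines \<open>m\<close> (\<open>measure_eqI_cyl\<close>). Splitting
  \<open>Z(v)\<close> according to the first arrow turns additivity of \<open>m\<close> into the harmonicity of \<open>\<psi>\<close>.

  Conversely, a harmonic \<open>\<psi>\<close> yields transition probabilities
  \<open>k(a, b) = exp (- \<beta> F(b)) \<psi>(head b) / \<psi>(head a)\<close> between arrows \<open>a\<close> and \<open>b\<close> with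
  \<open>head a = tail b\<close>: harmonicity at \<open>head a\<close> says that they sum to one. The Ionescu-Tulcea theorem
  provides a Markov chain with this kernel (\<open>ex_markov_chain\<close>). Its initial law \<open>q\<close> is any
  probability that charges every arrow, and the density \<open>exp (- \<beta> F(a)) \<psi>(head a) / q(a)\<close> in the
  first arrow \<open>a\<close> replaces \<open>q\<close> by the initial weights that are wanted, which may have infinite total
  mass. In the mass of a cylinder the product of the transition probabilities telescopes to its weight
  (\<open>ex_measure_of_weights\<close>), and the sequences that are not paths are null. Finally, a measure
  whose cylinders have these weights is conformal on all Borel sets, because both sides of the
  conformality equation are measures that agree on the cylinders (\<open>conformal_scaling_of_cyl\<close>).
\<close>

section \<open>Cylinder sets\<close>

text \<open>
  The start vertex is recorded separately so that \<open>Z(v)\<close> is the cylinder of the empty list. An \<open>xs\<close>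
  that is not a path from \<open>v\<close> gives the empty set.
\<close>

definition cyl :: "('v, 'a) pre_digraph \<Rightarrow> 'v \<Rightarrow> 'a list \<Rightarrow> (nat \<Rightarrow> 'a) set" where
  "cyl G v xs = {p \<in> vertex_cyl G v. \<forall>i<length xs. p i = xs ! i}"

lemma cyl_Nil [simp]: "cyl G v [] = vertex_cyl G v"
  by (simp add: cyl_def)

lemma inf_paths_arc: "p \<in> inf_paths G \<Longrightarrow> p i \<in> arcs G"
  by (simp add: inf_paths_def)

lemma cyl_Cons: "cyl G v (a # xs) = {p \<in> vertex_cyl G v. p 0 = a \<and> (\<forall>i<length xs. p (Suc i) = xs ! i)}"
  by (auto simp: cyl_def less_Suc_eq_0_disj)

lemma cyl_subset: "cyl G v xs \<subseteq> inf_paths G"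
  by (auto simp: cyl_def vertex_cyl_def)

text \<open>
  If the two cylinders share a path, then both start vertices are its start and both lists are among its
  prefixes, so the longer list extends the shorter one.
\<close>

lemma cyl_Int_longer:
  assumes "length xs \<le> length ys"
  shows "cyl G v xs \<inter> cyl G w ys = {} \<or> cyl G v xs \<inter> cyl G w ys = cyl G w ys"
proof (cases "cyl G v xs \<inter> cyl G w ys = {}")
  case False
  then obtain p where p: "p \<in> cyl G v xs" "p \<in> cyl G w ys"
    by blast
  then have "v = w"
    by (simp add: cyl_def vertex_cyl_def)
  have "q \<in> cyl G v xs" if q: "q \<in> cyl G w ys" for q
  proof -
    have "q i = xs ! i" if "i < length xs" for i
    proof -
      have "i < length ys" using that assms by simp
      then have "q i = ys ! i" "p i = ys ! i"
        using p(2) q by (auto simp: cyl_def)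
      moreover have "p i = xs ! i"
        using p(1) that by (auto simp: cyl_def)
      ultimately show ?thesis by simp
    qed
    then show ?thesis
      using q \<open>v = w\<close> by (simp add: cyl_def)
  qed
  then show ?thesis by blast
qed simp

text \<open>
  The empty set is adjoined because two cylinders may be disjoint.
\<close>

lemma Int_stable_cyl: "Int_stable (insert {} (range (case_prod (cyl G))))"
proof (rule Int_stableI)
  fix X Y
  assume X: "X \<in> insert {} (range (case_prod (cyl G)))"
    and Y: "Y \<in> insert {} (range (case_prod (cyl G)))"
  show "X \<inter> Y \<in> insert {} (range (case_prod (cyl G)))"
  proof (cases "X = {} \<or> Y = {}")
    case False
    then obtain v xs w ys where *: "X = cyl G v xs" "Y = cyl G w ys"
      using X Y by auto
    show ?thesis
    proof (cases "length xs \<le> length ys")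
      case True
      then show ?thesis
        using cyl_Int_longer[OF True, of G v w] Y unfolding * by auto
    next
      case False
      then show ?thesis
        using cyl_Int_longer[of ys xs G w v] X unfolding * by (auto simp: Int_commute)
    qed
  qed auto
qed

definition prepend :: "'a \<Rightarrow> (nat \<Rightarrow> 'a) \<Rightarrow> nat \<Rightarrow> 'a" where
  "prepend a p = (\<lambda>i. case i of 0 \<Rightarrow> a | Suc j \<Rightarrow> p j)"

lemma prepend_simps [simp]: "prepend a p 0 = a" "prepend a p (Suc i) = p i"
  by (simp_all add: prepend_def)

lemma path_shift_prepend [simp]: "path_shift (prepend a p) = p"
  by (simp add: path_shift_def)

lemma prepend_path_shift: "p 0 = a \<Longrightarrow> prepend a (path_shift p) = p"
  by (auto simp: path_shift_def prepend_def split: nat.split)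

lemma prepend_in_inf_paths:
  assumes "a \<in> arcs G"
  shows "prepend a p \<in> inf_paths G \<longleftrightarrow> p \<in> vertex_cyl G (head G a)"
proof
  assume *: "prepend a p \<in> inf_paths G"
  have "p i \<in> arcs G \<and> head G (p i) = tail G (p (Suc i))" for i
    using *[unfolded inf_paths_def, simplified, rule_format, of "Suc i"] by simp
  moreover have "head G a = tail G (p 0)"
    using *[unfolded inf_paths_def, simplified, rule_format, of 0] by simp
  ultimately show "p \<in> vertex_cyl G (head G a)"
    by (auto simp: inf_paths_def vertex_cyl_def)
next
  assume *: "p \<in> vertex_cyl G (head G a)"
  have "prepend a p i \<in> arcs G \<and> head G (prepend a p i) = tail G (prepend a p (Suc i))" for i
    using assms * by (cases i) (auto simp: inf_paths_def vertex_cyl_def)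
  then show "prepend a p \<in> inf_paths G"
    by (auto simp: inf_paths_def)
qed

text \<open>
  Writing the image under the shift as a preimage under \<open>prepend a\<close> makes its measurability and its
  measure accessible: \<open>prepend a\<close> is the inverse of the shift on the paths that begin with \<open>a\<close>.
\<close>

lemma path_shift_image:
  assumes "a \<in> arcs G" "B \<subseteq> inf_paths G"
  shows "path_shift ` (B \<inter> arrow_cyl G a) = prepend a -` B \<inter> vertex_cyl G (head G a)"
proof (intro equalityI subsetI)
  fix p assume "p \<in> path_shift ` (B \<inter> arrow_cyl G a)"
  then obtain q where q: "q \<in> B" "q 0 = a" "p = path_shift q"
    by (auto simp: arrow_cyl_def)
  then have "prepend a p = q"
    by (simp add: prepend_path_shift)
  then show "p \<in> prepend a -` B \<inter> vertex_cyl G (head G a)"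
    using q assms prepend_in_inf_paths[OF assms(1), of p] by auto
next
  fix p assume "p \<in> prepend a -` B \<inter> vertex_cyl G (head G a)"
  then have "prepend a p \<in> B \<inter> arrow_cyl G a"
    using assms by (auto simp: arrow_cyl_def)
  then show "p \<in> path_shift ` (B \<inter> arrow_cyl G a)"
    by (metis image_eqI path_shift_prepend)
qed

lemma prepend_vimage_cyl_Nil:
  assumes "a \<in> arcs G"
  shows "prepend a -` cyl G v [] \<inter> vertex_cyl G (head G a) =
    (if tail G a = v then cyl G (head G a) [] else {})"
proof -
  have "prepend a p \<in> cyl G v [] \<longleftrightarrow> p \<in> vertex_cyl G (head G a) \<and> tail G a = v" for p
    using prepend_in_inf_paths[OF assms, of p] by (simp add: vertex_cyl_def[of G v])
  then show ?thesis
    by auto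
qed

lemma prepend_vimage_cyl_Cons:
  assumes "a \<in> arcs G"
  shows "prepend a -` cyl G v (b # xs) \<inter> vertex_cyl G (head G a) =
    (if tail G a = v \<and> b = a then cyl G (head G a) xs else {})"
proof -
  have "prepend a p \<in> cyl G v (b # xs) \<longleftrightarrow>
      p \<in> vertex_cyl G (head G a) \<and> tail G a = v \<and> b = a \<and> (\<forall>i<length xs. p i = xs ! i)" for p
    using prepend_in_inf_paths[OF assms, of p] by (auto simp: cyl_Cons vertex_cyl_def)
  then show ?thesis
    by (auto simp: cyl_def)
qed

lemma path_shift_image_cyl:
  assumes "a \<in> out_arcs G v"
  shows "path_shift ` (cyl G v (a # xs) \<inter> arrow_cyl G a) = cyl G (head G a) xs"
proof -
  have a: "a \<in> arcs G" "tail G a = v"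
    using assms by auto
  show ?thesis
    unfolding path_shift_image[OF a(1) cyl_subset] prepend_vimage_cyl_Cons[OF a(1)]
    using a(2) by simp
qed

lemma cyl_Cons_not_out_arc: "a \<notin> out_arcs G v \<Longrightarrow> cyl G v (a # xs) = {}"
  using inf_paths_arc[of _ G 0] by (auto simp: cyl_Cons vertex_cyl_def)

lemma vertex_cyl_eq_UN: "vertex_cyl G v = (\<Union>a\<in>out_arcs G v. cyl G v [a])"
  using inf_paths_arc[of _ G 0] by (auto simp: cyl_Cons vertex_cyl_def)

lemma disjoint_cyl_single: "disjoint_family_on (\<lambda>a. cyl G v [a]) I"
  by (auto simp: disjoint_family_on_def cyl_Cons)

text \<open>
  A cylinder restricts only finitely many coordinates, and with a discrete arrow space every such
  restriction is open.
\<close>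

lemma openin_cyl: "openin (path_topology G) (cyl G v xs)"
proof -
  let ?X = "\<lambda>i. {a \<in> arcs G. (i = 0 \<longrightarrow> tail G a = v) \<and> (i < length xs \<longrightarrow> a = xs ! i)}"
  have fin: "finite {i. ?X i \<noteq> arcs G}"
    by (rule finite_subset[of _ "{..length xs}"]) auto
  have "openin (product_topology (\<lambda>_. discrete_topology (arcs G)) UNIV) (PiE UNIV ?X)"
    by (subst openin_PiE_gen) (use fin in auto)
  moreover have "cyl G v xs = PiE UNIV ?X \<inter> inf_paths G"
    by (auto simp: cyl_def vertex_cyl_def inf_paths_def PiE_iff)
  ultimately show ?thesis
    unfolding path_topology_def openin_subtopology by blast
qed

lemma path_open_subset: "openin (path_topology G) U \<Longrightarrow> U \<subseteq> inf_paths G"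
  unfolding path_topology_def openin_subtopology by blast

text \<open>
  A basic neighbourhood of \<open>p\<close> restricts only coordinates below some \<open>n\<close>, so it contains every path that
  agrees with \<open>p\<close> up to \<open>n\<close>.
\<close>

lemma path_open_contains_cyl:
  assumes U: "openin (path_topology G) U" and p: "p \<in> U"
  shows "\<exists>n. cyl G (tail G (p 0)) (map p [0..<n]) \<subseteq> U"
proof -
  obtain T where T: "openin (product_topology (\<lambda>_. discrete_topology (arcs G)) UNIV) T"
    and UT: "U = T \<inter> inf_paths G"
    using U unfolding path_topology_def openin_subtopology by blast
  then obtain X where X: "finite {i. X i \<noteq> arcs G}" "p \<in> PiE UNIV X" "PiE UNIV X \<subseteq> T"
    using p T unfolding openin_product_topology_alt by (auto 0 4)
  obtain n where n: "{i. X i \<noteq> arcs G} \<subseteq> {..<n}"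
    using X(1) finite_nat_iff_bounded by auto
  have "cyl G (tail G (p 0)) (map p [0..<n]) \<subseteq> U"
  proof
    fix q assume q: "q \<in> cyl G (tail G (p 0)) (map p [0..<n])"
    then have qP: "q \<in> inf_paths G" and eq: "\<And>i. i < n \<Longrightarrow> q i = p i"
      by (auto simp: cyl_def vertex_cyl_def)
    have "q i \<in> X i" for i
    proof (cases "i < n")
      case True
      then show ?thesis using eq X(2) by (auto simp: PiE_iff)
    next
      case False
      then have "X i = arcs G" using n by auto
      then show ?thesis using qP by (auto simp: inf_paths_def)
    qed
    then show "q \<in> U" using X(3) qP UT by (auto simp: PiE_iff)
  qed
  then show ?thesis ..
qed

section \<open>The Borel sets\<close>

locale countable_digraph = wf_digraph G for G :: "('v, 'a) pre_digraph" +
  assumes countable_verts: "countable (verts G)"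
    and countable_arcs: "countable (arcs G)"
begin

lemma countable_out_arcs: "countable (out_arcs G v)"
  using countable_arcs by (rule countable_subset[rotated]) auto

lemma inf_paths_eq_UN: "inf_paths G = (\<Union>v\<in>verts G. vertex_cyl G v)"
  using inf_paths_arc[of _ G 0] tail_in_verts by (fastforce simp: vertex_cyl_def)

lemma vertex_cyl_outside: "v \<notin> verts G \<Longrightarrow> vertex_cyl G v = {}"
  using inf_paths_arc[of _ G 0] tail_in_verts by (fastforce simp: vertex_cyl_def)

text \<open>
  An open set is the union of the cylinders that it contains. With countably many vertices and arrows there are only
  countably many nonempty cylinders, so this union stays in the generated \<open>\<sigma>\<close>-algebra.
\<close>

lemma sets_path_borel:
  "sets (path_borel G) = sigma_sets (inf_paths G) (insert {} (range (case_prod (cyl G))))"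
    (is "_ = sigma_sets _ ?E")
proof -
  have sub: "{U. openin (path_topology G) U} \<subseteq> Pow (inf_paths G)"
    using path_open_subset by blast
  have "sigma_sets (inf_paths G) {U. openin (path_topology G) U} = sigma_sets (inf_paths G) ?E"
  proof (rule sigma_sets_eqI)
    fix U assume "U \<in> {U. openin (path_topology G) U}"
    then have U: "openin (path_topology G) U" by simp
    define I where "I = {(v, xs) \<in> verts G \<times> lists (arcs G). cyl G v xs \<subseteq> U}"
    have "countable I"
      by (rule countable_subset[of _ "verts G \<times> lists (arcs G)"])
        (auto simp: I_def countable_verts countable_arcs)
    moreover have "U = (\<Union>(v, xs)\<in>I. cyl G v xs)"
    proof (intro equalityI subsetI)
      fix p assume p: "p \<in> U"
      then obtain n where n: "cyl G (tail G (p 0)) (map p [0..<n]) \<subseteq> U"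
        using path_open_contains_cyl[OF U] by blast
      have P: "p \<in> inf_paths G"
        using U sub p by blast
      then have "(tail G (p 0), map p [0..<n]) \<in> I"
        using n inf_paths_arc[OF P] tail_in_verts by (auto simp: I_def)
      moreover have "p \<in> cyl G (tail G (p 0)) (map p [0..<n])"
        using P by (auto simp: cyl_def vertex_cyl_def)
      ultimately show "p \<in> (\<Union>(v, xs)\<in>I. cyl G v xs)"
        by blast
    qed (auto simp: I_def)
    moreover have "(\<Union>(v, xs)\<in>I. cyl G v xs) \<in> sigma_sets (inf_paths G) ?E" if "countable I"
      using that by (intro sigma_sets_UNION) (auto intro!: sigma_sets.Basic)
    ultimately show "U \<in> sigma_sets (inf_paths G) ?E"
      by simp
  next
    fix X assume "X \<in> ?E"
    then have "openin (path_topology G) X"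
      using openin_cyl[of G] openin_empty by fast
    then show "X \<in> sigma_sets (inf_paths G) {U. openin (path_topology G) U}"
      by (intro sigma_sets.Basic) simp
  qed
  then show ?thesis
    using sub by (simp add: path_borel_def)
qed

lemma space_path_borel: "space (path_borel G) = inf_paths G"
  unfolding path_borel_def by (rule space_measure_of) (use path_open_subset in blast)

lemma cyl_in_path_borel [measurable]: "cyl G v xs \<in> sets (path_borel G)"
  unfolding sets_path_borel by auto

lemma vertex_cyl_in_path_borel [measurable]: "vertex_cyl G v \<in> sets (path_borel G)"
  using cyl_in_path_borel[of v "[]"] by simp

lemma arrow_cyl_in_path_borel: "arrow_cyl G a \<in> sets (path_borel G)"
proof -
  have "arrow_cyl G a = cyl G (tail G a) [a]"
    by (auto simp: cyl_Cons arrow_cyl_def vertex_cyl_def)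
  then show ?thesis by simp
qed

lemma measurable_into_path_borel:
  assumes "f \<in> space M \<rightarrow> inf_paths G"
    and "\<And>v xs. f -` cyl G v xs \<inter> space M \<in> sets M"
  shows "f \<in> measurable M (path_borel G)"
  using assms by (intro measurable_sigma_sets[OF sets_path_borel]) (auto simp: cyl_subset[THEN subsetD])

text \<open>
  Uniqueness of measures on a generating \<open>\<pi>\<close>-system; the sets \<open>Z(v)\<close> are the countable cover by sets
  of finite measure.
\<close>

lemma measure_eqI_cyl:
  assumes sets: "sets m = sets (path_borel G)" "sets m' = sets (path_borel G)"
    and eq: "\<And>v xs. v \<in> verts G \<Longrightarrow> emeasure m (cyl G v xs) = emeasure m' (cyl G v xs)"
    and fin: "\<And>v. v \<in> verts G \<Longrightarrow> emeasure m (vertex_cyl G v) \<noteq> \<infinity>"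
  shows "m = m'"
proof (rule measure_eqI_generator_eq_countable[OF Int_stable_cyl])
  show "insert {} (range (case_prod (cyl G))) \<subseteq> Pow (inf_paths G)"
    using cyl_subset[of G] by (simp add: image_subset_iff)
  show "sets m = sigma_sets (inf_paths G) (insert {} (range (case_prod (cyl G))))"
    "sets m' = sigma_sets (inf_paths G) (insert {} (range (case_prod (cyl G))))"
    using sets by (simp_all only: sets_path_borel)
  show "emeasure m X = emeasure m' X" if "X \<in> insert {} (range (case_prod (cyl G)))" for X
  proof (cases "X = {}")
    case False
    then have "X \<in> range (case_prod (cyl G))"
      using that by (simp only: insert_iff) simp
    then obtain z where "X = case_prod (cyl G) z"
      by (rule imageE)
    then obtain v xs where X: "X = cyl G v xs"
      by (cases z) simp
    then obtain p where "p \<in> vertex_cyl G v"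
      using False unfolding cyl_def by blast
    then have "v \<in> verts G"
      using vertex_cyl_outside[of v] by blast
    then show ?thesis using eq X by simp
  qed simp
  show "vertex_cyl G ` verts G \<subseteq> insert {} (range (case_prod (cyl G)))"
  proof
    fix X assume "X \<in> vertex_cyl G ` verts G"
    then obtain v where "X = case_prod (cyl G) (v, [])" unfolding case_prod_conv cyl_Nil by blast
    then show "X \<in> insert {} (range (case_prod (cyl G)))" by blast
  qed
  show "\<Union> (vertex_cyl G ` verts G) = inf_paths G"
    by (simp add: inf_paths_eq_UN)
  show "countable (vertex_cyl G ` verts G)"
    using countable_verts by simp
  show "\<And>X. X \<in> vertex_cyl G ` verts G \<Longrightarrow> emeasure m X \<noteq> \<infinity>"
    using fin by auto
qed

end

section \<open>Weights of cylinders and conformality\<close>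

lemma exp_scaling_inverse: "ennreal (exp x) * (ennreal (exp (- x)) * y) = y"
  by (simp add: mult.assoc[symmetric] ennreal_mult[symmetric] exp_minus)

text \<open>
  For a path \<open>xs = a\<^sub>1 ... a\<^sub>n\<close> from \<open>v\<close> to \<open>w\<close> this is \<open>exp (- \<beta> (F(a\<^sub>1) + ... + F(a\<^sub>n))) * f(w)\<close>; it is
  \<open>0\<close> when \<open>xs\<close> is not a path from \<open>v\<close>. The recursion from the front is the one that the shift induces
  on cylinders.
\<close>

fun weight :: "('v, 'a) pre_digraph \<Rightarrow> ('a \<Rightarrow> real) \<Rightarrow> real \<Rightarrow> ('v \<Rightarrow> ennreal) \<Rightarrow> 'v \<Rightarrow> 'a list \<Rightarrow> ennreal"
  where
    "weight G F \<beta> f v [] = f v"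
  | "weight G F \<beta> f v (a # xs) =
      (if a \<in> out_arcs G v then ennreal (exp (- \<beta> * F a)) * weight G F \<beta> f (head G a) xs else 0)"

text \<open>
  The weight is defined by recursion from the front, whereas a Markov chain extends its past at the
  end. This lemma passes from one to the other: \<open>c\<close> is a transition probability from \<open>a\<close> to \<open>b\<close>, or \<open>0\<close>
  when \<open>b\<close> cannot follow \<open>a\<close>.
\<close>

lemma weight_snoc:
  assumes "c * f (head G a) = weight G F \<beta> f (head G a) [b]"
  shows "weight G F \<beta> f v (xs @ [a, b]) = c * weight G F \<beta> f v (xs @ [a])"
proof (induction xs arbitrary: v)
  case Nil
  have "weight G F \<beta> f v [a, b] =
      (if a \<in> out_arcs G v then ennreal (exp (- \<beta> * F a)) * weight G F \<beta> f (head G a) [b] else 0)"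
    by (rule weight.simps(2))
  then show ?case
    unfolding assms[symmetric] by (simp add: mult_ac)
qed (simp add: mult_ac)

lemma weight_cong:
  assumes "wf_digraph G" "\<And>w. w \<in> verts G \<Longrightarrow> f w = g w" "v \<in> verts G"
  shows "weight G F \<beta> f v xs = weight G F \<beta> g v xs"
  using assms(3)
proof (induction xs arbitrary: v)
  case (Cons a xs)
  then show ?case
    using wf_digraph.head_in_verts[OF assms(1), of a] by simp
qed (simp add: assms(2))

context countable_digraph
begin

text \<open>
  Each step of the induction is conformality for the Borel set \<open>cyl G v (a # xs)\<close>, whose shift is
  \<open>cyl G (head G a) xs\<close>.
\<close>

lemma conformal_measure_cyl:
  assumes m: "conformal_measure G F \<beta> m"
  shows "emeasure m (cyl G v xs) = weight G F \<beta> (\<lambda>w. emeasure m (vertex_cyl G w)) v xs"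
proof (induction xs arbitrary: v)
  case (Cons a xs)
  show ?case
  proof (cases "a \<in> out_arcs G v")
    case True
    then have "a \<in> arcs G" by simp
    have cyl: "cyl G v (a # xs) \<inter> arrow_cyl G a = cyl G v (a # xs)"
      by (auto simp: cyl_Cons arrow_cyl_def vertex_cyl_def)
    have "emeasure m (path_shift ` (cyl G v (a # xs) \<inter> arrow_cyl G a)) =
        ennreal (exp (\<beta> * F a)) * emeasure m (cyl G v (a # xs) \<inter> arrow_cyl G a)"
      using m \<open>a \<in> arcs G\<close> cyl_in_path_borel unfolding conformal_measure_def by blast
    then have "emeasure m (cyl G (head G a) xs) = ennreal (exp (\<beta> * F a)) * emeasure m (cyl G v (a # xs))"
      using path_shift_image_cyl[OF True, of xs] cyl by simp
    then show ?thesis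
      using True exp_scaling_inverse[of "- \<beta> * F a"] by (simp add: Cons.IH[symmetric])
  next
    case False
    then show ?thesis
      by (simp only: cyl_Cons_not_out_arc[OF False] weight.simps if_False emeasure_empty)
  qed
qed simp

lemma measurable_prepend:
  assumes sets: "sets m = sets (path_borel G)" and a: "a \<in> arcs G"
  shows "prepend a \<in> restrict_space m (vertex_cyl G (head G a)) \<rightarrow>\<^sub>M path_borel G"
proof -
  have Z: "vertex_cyl G (head G a) \<in> sets m"
    using sets by simp
  then have space: "space (restrict_space m (vertex_cyl G (head G a))) = vertex_cyl G (head G a)"
    using sets.sets_into_space[OF Z] by (simp add: space_restrict_space Int_absorb2)
  show ?thesis
  proof (rule measurable_into_path_borel)
    show "prepend a \<in> space (restrict_space m (vertex_cyl G (head G a))) \<rightarrow> inf_paths G"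
      unfolding space using prepend_in_inf_paths[OF a] by blast
    show "prepend a -` cyl G v xs \<inter> space (restrict_space m (vertex_cyl G (head G a)))
      \<in> sets (restrict_space m (vertex_cyl G (head G a)))" for v xs
    proof -
      have *: "cyl G (head G a) ys \<in> sets (restrict_space m (vertex_cyl G (head G a)))" for ys
      proof -
        have "cyl G (head G a) ys \<subseteq> vertex_cyl G (head G a)"
          unfolding cyl_def by blast
        then show ?thesis
          using Z by (subst sets_restrict_space_iff) (simp_all add: sets sets.Int_space_eq2)
      qed
      then show ?thesis
        unfolding space
        using *[of "[]"] prepend_vimage_cyl_Nil[OF a, of v]
        by (cases xs) (simp_all add: * prepend_vimage_cyl_Cons[OF a])
    qed
  qed
qed

text \<open>
  Both sides of the conformality equation are measures in \<open>B\<close>: the left side is the image \<open>\<mu>\<close> of \<open>m\<close> on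
  \<open>Z(r(a))\<close> under \<open>prepend a\<close>, and the right side is the restriction \<open>\<nu>\<close> of \<open>m\<close> to \<open>Z(a)\<close>, scaled by a
  constant. On cylinders they agree by the recursion of the weights, hence everywhere.
\<close>

lemma conformal_scaling_of_cyl:
  assumes sets: "sets m = sets (path_borel G)"
    and fin: "\<And>v. v \<in> verts G \<Longrightarrow> emeasure m (vertex_cyl G v) < \<infinity>"
    and cyl: "\<And>v xs. v \<in> verts G \<Longrightarrow> emeasure m (cyl G v xs) = weight G F \<beta> f v xs"
    and a: "a \<in> arcs G" and B: "B \<in> sets (path_borel G)"
  shows "emeasure m (path_shift ` (B \<inter> arrow_cyl G a)) =
    ennreal (exp (\<beta> * F a)) * emeasure m (B \<inter> arrow_cyl G a)"
proof -
  let ?Z = "vertex_cyl G (head G a)" and ?A = "arrow_cyl G a"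
  define \<mu> where "\<mu> = distr (restrict_space m ?Z) (path_borel G) (prepend a)"
  define \<nu> where "\<nu> = scale_measure (ennreal (exp (\<beta> * F a))) (density m (indicator ?A))"
  have spaces: "space m = inf_paths G"
    using sets_eq_imp_space_eq[OF sets] by (simp add: space_path_borel)
  have Z_space: "space (restrict_space m ?Z) = ?Z"
    unfolding space_restrict_space spaces by (auto simp: vertex_cyl_def)
  have \<mu>: "emeasure \<mu> C = emeasure m (prepend a -` C \<inter> ?Z)" if "C \<in> sets (path_borel G)" for C
  proof -
    have "?Z \<inter> space m \<in> sets m"
      using sets by (simp add: sets.Int_space_eq2)
    then show ?thesis
      unfolding \<mu>_def
      by (subst emeasure_distr[OF measurable_prepend[OF sets a] that])
        (simp_all add: Z_space emeasure_restrict_space)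
  qed
  have \<nu>: "emeasure \<nu> C = ennreal (exp (\<beta> * F a)) * emeasure m (?A \<inter> C)"
    if "C \<in> sets (path_borel G)" for C
    unfolding \<nu>_def using that arrow_cyl_in_path_borel sets by (simp add: emeasure_restricted)
  have "\<mu> = \<nu>"
  proof (rule measure_eqI_cyl)
    show "sets \<mu> = sets (path_borel G)" "sets \<nu> = sets (path_borel G)"
      by (simp_all add: \<mu>_def \<nu>_def sets)
    have head: "head G a \<in> verts G"
      using a by simp
    show "emeasure \<mu> (vertex_cyl G v) \<noteq> \<infinity>" for v
    proof -
      have "emeasure \<mu> (vertex_cyl G v) \<le> emeasure m ?Z"
        using sets by (simp add: \<mu>) (intro emeasure_mono; simp)
      also have "\<dots> < \<infinity>" using fin head by blast
      finally show ?thesis by simp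
    qed
    fix v xs
    assume v: "v \<in> verts G"
    show "emeasure \<mu> (cyl G v xs) = emeasure \<nu> (cyl G v xs)"
    proof (cases xs)
      case Nil
      have "?A \<inter> cyl G v [] = (if tail G a = v then cyl G v [a] else {})"
        by (auto simp: arrow_cyl_def vertex_cyl_def cyl_Cons)
      then have "emeasure \<nu> (cyl G v []) = (if tail G a = v then f (head G a) else 0)"
        using exp_scaling_inverse[of "\<beta> * F a"]
        by (simp only: \<nu> cyl_in_path_borel) (simp add: cyl[OF v] a)
      then show ?thesis
        unfolding Nil by (simp only: \<mu> cyl_in_path_borel prepend_vimage_cyl_Nil[OF a])
          (simp add: cyl[OF head] del: cyl_Nil)
    next
      case (Cons b ys)
      have "?A \<inter> cyl G v (b # ys) = (if tail G a = v \<and> b = a then cyl G v (a # ys) else {})"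
        by (auto simp: arrow_cyl_def vertex_cyl_def cyl_Cons)
      then have "emeasure \<nu> (cyl G v (b # ys)) =
          (if tail G a = v \<and> b = a then weight G F \<beta> f (head G a) ys else 0)"
        using exp_scaling_inverse[of "\<beta> * F a"]
        by (simp only: \<nu> cyl_in_path_borel) (simp add: cyl[OF v] a)
      then show ?thesis
        unfolding Cons by (simp only: \<mu> cyl_in_path_borel prepend_vimage_cyl_Cons[OF a])
          (simp add: cyl[OF head])
    qed
  qed
  moreover have "B \<subseteq> inf_paths G"
    using sets.sets_into_space[OF B] by (simp add: space_path_borel)
  ultimately show ?thesis
    using \<mu>[OF B] \<nu>[OF B] path_shift_image[OF a] by (simp add: Int_commute)
qed

end

section \<open>Harmonicity\<close>

text \<open>
  This moves sums over countable sets to integrals, where the order of summation can be exchanged and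
  countable additivity of measures is available.
\<close>

lemma nn_integral_count_space_eq_infsum:
  fixes f :: "'b \<Rightarrow> ennreal"
  assumes "countable A"
  shows "(\<integral>\<^sup>+x. f x \<partial>count_space A) = (\<Sum>\<^sub>\<infinity>x\<in>A. f x)"
proof -
  have SUP: "(\<Sum>\<^sub>\<infinity>x\<in>A. f x) = (SUP S\<in>{S. finite S \<and> S \<subseteq> A}. sum f S)"
    by (rule nonneg_infsum_complete) simp
  show ?thesis
  proof (rule antisym)
    show "(\<Sum>\<^sub>\<infinity>x\<in>A. f x) \<le> (\<integral>\<^sup>+x. f x \<partial>count_space A)"
      unfolding SUP
    proof (rule SUP_least)
      fix S assume "S \<in> {S. finite S \<and> S \<subseteq> A}"
      then have "sum f S = (\<integral>\<^sup>+x. f x * indicator S x \<partial>count_space A)"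
        by (subst nn_integral_indicator_finite) (auto simp: subset_iff)
      also have "\<dots> \<le> (\<integral>\<^sup>+x. f x \<partial>count_space A)"
        by (intro nn_integral_mono) (auto split: split_indicator)
      finally show "sum f S \<le> (\<integral>\<^sup>+x. f x \<partial>count_space A)" .
    qed
    show "(\<integral>\<^sup>+x. f x \<partial>count_space A) \<le> (\<Sum>\<^sub>\<infinity>x\<in>A. f x)"
    proof (cases "finite A")
      case True
      then show ?thesis by (simp add: nn_integral_count_space_finite)
    next
      case False
      then have bij: "bij_betw (from_nat_into A) UNIV A"
        using assms bij_betw_from_nat_into by blast
      have "(\<integral>\<^sup>+x. f x \<partial>count_space A) = (\<Sum>i. f (from_nat_into A i))"
        by (simp add: nn_integral_bij_count_space[OF bij, symmetric] nn_integral_count_space_nat)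
      also have "\<dots> = (SUP n. \<Sum>i<n. f (from_nat_into A i))"
        by (rule suminf_eq_SUP)
      also have "\<dots> \<le> (\<Sum>\<^sub>\<infinity>x\<in>A. f x)"
        unfolding SUP
      proof (intro SUP_least SUP_upper2)
        fix n
        show "from_nat_into A ` {..<n} \<in> {S. finite S \<and> S \<subseteq> A}"
          using bij by (auto simp: bij_betw_def)
        show "(\<Sum>i<n. f (from_nat_into A i)) \<le> sum f (from_nat_into A ` {..<n})"
          using bij by (subst sum.reindex) (auto simp: bij_betw_def inj_on_def)
      qed
      finally show ?thesis .
    qed
  qed
qed

context countable_digraph
begin

text \<open>
  Every path from \<open>v\<close> has exactly one first arrow. This additivity is what becomes harmonicity.
\<close>

lemma emeasure_vertex_cyl:
  assumes "sets m = sets (path_borel G)"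
  shows "emeasure m (vertex_cyl G v) = (\<integral>\<^sup>+a. emeasure m (cyl G v [a]) \<partial>count_space (out_arcs G v))"
proof -
  have "emeasure m (\<Union>a\<in>out_arcs G v. cyl G v [a]) =
      (\<integral>\<^sup>+a. emeasure m (cyl G v [a]) \<partial>count_space (out_arcs G v))"
    using assms by (intro emeasure_UN_countable countable_out_arcs disjoint_cyl_single) simp
  then show ?thesis
    by (simp only: vertex_cyl_eq_UN[symmetric])
qed

text \<open>
  Grouping the arrows emitted by \<open>v\<close> according to their range, and exchanging the two sums.
\<close>

lemma harmonic_sum_eq:
  assumes v: "v \<in> verts G"
  shows "(\<Sum>\<^sub>\<infinity>w\<in>verts G. adj_matrix G F \<beta> v w * f w) =
    (\<integral>\<^sup>+a. ennreal (exp (- \<beta> * F a)) * f (head G a) \<partial>count_space (out_arcs G v))"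
proof -
  let ?e = "\<lambda>a. ennreal (exp (- \<beta> * F a))"
  let ?B = "\<lambda>w. {a \<in> arcs G. tail G a = v \<and> head G a = w}"
  have adj: "adj_matrix G F \<beta> v w * f w =
      (\<integral>\<^sup>+a. ?e a * f w * indicator {head G a} w \<partial>count_space (out_arcs G v))" for w
  proof -
    have "countable (?B w)"
      using countable_arcs by (rule countable_subset[rotated]) auto
    then have "adj_matrix G F \<beta> v w = (\<integral>\<^sup>+a. ?e a \<partial>count_space (?B w))"
      by (simp add: adj_matrix_def nn_integral_count_space_eq_infsum)
    also have "\<dots> = (\<integral>\<^sup>+a. ?e a * indicator {head G a} w \<partial>count_space (out_arcs G v))"
      by (auto simp: nn_integral_count_space_indicator intro!: nn_integral_cong split: split_indicator)
    finally have "adj_matrix G F \<beta> v w * f w =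
        (\<integral>\<^sup>+a. ?e a * indicator {head G a} w * f w \<partial>count_space (out_arcs G v))"
      by (simp add: nn_integral_multc)
    then show ?thesis
      by (simp add: mult_ac)
  qed
  have "(\<Sum>\<^sub>\<infinity>w\<in>verts G. adj_matrix G F \<beta> v w * f w) =
      (\<integral>\<^sup>+w. \<integral>\<^sup>+a. ?e a * f w * indicator {head G a} w \<partial>count_space (out_arcs G v) \<partial>count_space (verts G))"
    using countable_verts by (simp add: nn_integral_count_space_eq_infsum adj)
  also have "\<dots> = (\<integral>\<^sup>+a. \<integral>\<^sup>+w. ?e a * f w * indicator {head G a} w \<partial>count_space (verts G) \<partial>count_space (out_arcs G v))"
    by (rule nn_integral_count_space_nn_integral) (simp_all add: countable_out_arcs)
  also have "\<dots> = (\<integral>\<^sup>+a. ?e a * f (head G a) \<partial>count_space (out_arcs G v))"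
    by (intro nn_integral_cong, subst nn_integral_indicator_finite) auto
  finally show ?thesis .
qed

end

section \<open>Markov chains on a discrete state space\<close>

lemma sets_PiM_count_space_singleton:
  assumes "finite I" "y \<in> PiE I (\<lambda>_. A)"
  shows "{y} \<in> sets (PiM I (\<lambda>_. count_space A))"
proof -
  have "{y} = PiE I (\<lambda>i. {y i})"
    using PiE_singleton[of y I] assms(2) by (auto simp: PiE_iff)
  also have "\<dots> \<in> sets (PiM I (\<lambda>_. count_space A))"
    using assms by (intro sets_PiM_I_finite) (auto simp: PiE_iff)
  finally show ?thesis .
qed

text \<open>
  The cylinders of the full sequence space over \<open>A\<close>, in which consecutive letters need not fit together.
\<close>

definition prefixed :: "'a set \<Rightarrow> 'a list \<Rightarrow> (nat \<Rightarrow> 'a) set" where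
  "prefixed A xs = {\<omega>. range \<omega> \<subseteq> A \<and> (\<forall>i<length xs. \<omega> i = xs ! i)}"

locale discrete_Ionescu_Tulcea = Ionescu_Tulcea P "\<lambda>_. count_space A"
  for P :: "nat \<Rightarrow> (nat \<Rightarrow> 'a) \<Rightarrow> 'a measure" and A :: "'a set"
begin

text \<open>
  The law of the first \<open>n + 1\<close> coordinates is the law of the first \<open>n\<close> followed by the kernel at time \<open>n\<close>;
  for a single history the integral over the past reduces to one term.
\<close>

lemma emeasure_C_singleton_Suc:
  assumes y: "y \<in> PiE {0..<Suc n} (\<lambda>_. A)"
  shows "emeasure (C 0 (Suc n) (\<lambda>_. undefined)) {y} =
    emeasure (P n (restrict y {0..<n})) {y n} *
    emeasure (C 0 n (\<lambda>_. undefined)) {restrict y {0..<n}}"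
proof -
  let ?u = "\<lambda>_::nat. undefined :: 'a" and ?r = "restrict y {0..<n}"
  have u: "?u \<in> space (PiM {0..<0} (\<lambda>_. count_space A))"
    by (simp add: space_PiM)
  have r: "?r \<in> PiE {0..<n} (\<lambda>_. A)"
    using y by (auto simp: PiE_iff)
  have r_sets: "{?r} \<in> sets (C 0 n ?u)"
    using sets_PiM_count_space_singleton[OF _ r] sets_C[OF u, of n] by simp
  have y_sets: "{y} \<in> sets (PiM {0..<Suc n} (\<lambda>_. count_space A))"
    using sets_PiM_count_space_singleton[OF _ y] by simp
  have space: "space (C 0 n ?u) = PiE {0..<n} (\<lambda>_. A)"
    using space_C[OF u, of n] by (simp add: space_PiM)
  have "emeasure (C 0 (Suc n) ?u) {y} = (\<integral>\<^sup>+\<omega>. emeasure (eP n \<omega>) {y} \<partial>C 0 n ?u)"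
    unfolding C.simps add_0
  proof (rule emeasure_bind[OF _ _ y_sets])
    show "space (C 0 n ?u) \<noteq> {}" using r space by blast
    show "eP n \<in> C 0 n ?u \<rightarrow>\<^sub>M subprob_algebra (PiM {0..<Suc n} (\<lambda>_. count_space A))"
      using measurable_eP[of n] measurable_cong_sets[OF sets_C[OF u, of n], of "subprob_algebra (PiM {0..<Suc n} (\<lambda>_. count_space A))"]
      by simp
  qed
  also have "\<dots> = (\<integral>\<^sup>+\<omega>. emeasure (P n ?r) {y n} * indicator {?r} \<omega> \<partial>C 0 n ?u)"
  proof (rule nn_integral_cong)
    fix \<omega> assume "\<omega> \<in> space (C 0 n ?u)"
    then have w: "\<omega> \<in> PiE {0..<n} (\<lambda>_. A)" by (simp add: space)
    have eq: "fun_upd \<omega> n -` {y} \<inter> A = (if \<omega> = ?r then {y n} else {})"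
    proof (cases "\<omega> = ?r")
      case True
      have "?r(n := y n) = y"
        using y by (auto simp: fun_eq_iff PiE_iff extensional_def)
      moreover have "t = y n" if "?r(n := t) = y" for t
        using that by (metis fun_upd_same)
      ultimately show ?thesis
        using True y by (auto simp: PiE_iff)
    next
      case False
      have "\<omega> = ?r" if "fun_upd \<omega> n t = y" for t
        using w by (auto simp: that[symmetric] fun_eq_iff PiE_iff extensional_def)
      then show ?thesis using False by (auto dest: sym)
    qed
    then show "emeasure (eP n \<omega>) {y} = emeasure (P n ?r) {y n} * indicator {?r} \<omega>"
      using w emeasure_eP[OF _ y_sets, of \<omega>] by (simp add: space_PiM eq)
  qed
  also have "\<dots> = emeasure (P n ?r) {y n} * emeasure (C 0 n ?u) {?r}"
    using r_sets by (rule nn_integral_cmult_indicator)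
  finally show ?thesis .
qed

lemma emeasure_lim_prefixed:
  assumes xs: "set xs \<subseteq> A"
  shows "prefixed A xs \<in> sets (PiM UNIV (\<lambda>_. count_space A))"
    and "emeasure PF.lim (prefixed A xs) =
      emeasure (C 0 (length xs) (\<lambda>_. undefined)) {\<lambda>i\<in>{0..<length xs}. xs ! i}"
proof -
  let ?n = "length xs" let ?y = "\<lambda>i\<in>{0..<?n}. xs ! i"
  have y: "?y \<in> PiE {0..<?n} (\<lambda>_. A)"
    using xs by (auto simp: subset_iff)
  have y_sets: "{?y} \<in> sets (PiM {0..<?n} (\<lambda>_. count_space A))"
    using sets_PiM_count_space_singleton[OF _ y] by simp
  have emb: "prefixed A xs = PF.emb UNIV {0..<?n} {?y}"
    by (auto simp: prefixed_def prod_emb_def PiE_iff fun_eq_iff restrict_def; metis)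
  have "PF.emb UNIV {0..<?n} {?y} \<in> sets (PiM UNIV (\<lambda>_. count_space A))"
    using y_sets by (intro measurable_prod_emb) auto
  then show "prefixed A xs \<in> sets (PiM UNIV (\<lambda>_. count_space A))"
    unfolding emb by simp
  have "PF.emb {0..<?n} {0..<?n} {?y} = {?y}"
    using y by (auto simp: prod_emb_def PiE_iff)
  then show "emeasure PF.lim (prefixed A xs) = emeasure (C 0 ?n (\<lambda>_. undefined)) {?y}"
    unfolding emb using y_sets by (subst lim) (auto simp: emeasure_CI[of _ ?n])
qed

end

lemma prob_space_density_count_space:
  "(\<integral>\<^sup>+a. k a \<partial>count_space A) = 1 \<Longrightarrow> prob_space (density (count_space A) k)"
  by (rule prob_spaceI) (simp add: emeasure_density nn_integral_count_space_indicator[of A, symmetric]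
    cong: nn_integral_cong_simp)

text \<open>
  The chain has initial law \<open>q\<close> and transition kernel \<open>k\<close>. The transition equation is stated by multiplication,
  so it also holds for histories of probability zero.
\<close>

lemma ex_markov_chain:
  fixes q :: "'a \<Rightarrow> ennreal" and k :: "'a \<Rightarrow> 'a \<Rightarrow> ennreal"
  assumes q: "(\<integral>\<^sup>+a. q a \<partial>count_space A) = 1"
    and k: "\<And>a. a \<in> A \<Longrightarrow> (\<integral>\<^sup>+b. k a b \<partial>count_space A) = 1"
  obtains N where "sets N = sets (PiM UNIV (\<lambda>_::nat. count_space A))"
    and "\<And>xs. set xs \<subseteq> A \<Longrightarrow> prefixed A xs \<in> sets N"
    and "\<And>a. a \<in> A \<Longrightarrow> emeasure N (prefixed A [a]) = q a"
    and "\<And>xs a b. set (xs @ [a, b]) \<subseteq> A \<Longrightarrow>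
      emeasure N (prefixed A (xs @ [a, b])) = k a b * emeasure N (prefixed A (xs @ [a]))"
proof -
  define P where "P n \<omega> = (case n of 0 \<Rightarrow> density (count_space A) q
    | Suc i \<Rightarrow> density (count_space A) (k (\<omega> i)))" for n and \<omega> :: "nat \<Rightarrow> 'a"
  interpret discrete_Ionescu_Tulcea P A
    unfolding discrete_Ionescu_Tulcea_def
  proof (rule Ionescu_Tulcea.intro)
    fix n
    show "P n \<in> PiM {0..<n} (\<lambda>_. count_space A) \<rightarrow>\<^sub>M subprob_algebra (count_space A)"
    proof (cases n)
      case 0
      have "density (count_space A) q \<in> space (subprob_algebra (count_space A))"
        using prob_space_density_count_space[OF q]
        by (simp add: space_subprob_algebra prob_space_imp_subprob_space)
      then show ?thesis
        unfolding 0 P_def by simp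
    next
      case (Suc i)
      have "(\<lambda>a. density (count_space A) (k a)) \<in> count_space A \<rightarrow>\<^sub>M subprob_algebra (count_space A)"
        using prob_space_density_count_space[OF k]
        by (auto simp: space_subprob_algebra prob_space_imp_subprob_space)
      moreover have "(\<lambda>\<omega>. \<omega> i) \<in> PiM {0..<n} (\<lambda>_. count_space A) \<rightarrow>\<^sub>M count_space A"
        using Suc by (intro measurable_component_singleton) auto
      ultimately show ?thesis
        unfolding Suc P_def by (simp del: measurable_count_space_eq1 add: measurable_compose)
    qed
  next
    fix n and \<omega> :: "nat \<Rightarrow> 'a" assume "\<omega> \<in> space (PiM {0..<n} (\<lambda>_. count_space A))"
    then show "prob_space (P n \<omega>)"
      using prob_space_density_count_space[OF q] prob_space_density_count_space[OF k]
      by (cases n) (auto simp: P_def space_PiM PiE_iff)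
  qed
  have single: "emeasure (density (count_space A) f) {a} = f a" if "a \<in> A" for f a
    using that by (subst emeasure_density)
      (auto simp: nn_integral_indicator_finite nn_integral_indicator_singleton)
  show thesis
  proof (rule that[of PF.lim])
    show "sets PF.lim = sets (PiM UNIV (\<lambda>_::nat. count_space A))"
      by simp
    show "prefixed A xs \<in> sets PF.lim" if "set xs \<subseteq> A" for xs
      using emeasure_lim_prefixed(1)[OF that] by simp
    show "emeasure PF.lim (prefixed A [a]) = q a" if a: "a \<in> A" for a
    proof -
      let ?y = "\<lambda>i\<in>{0..<Suc 0}. [a] ! i"
      have y: "?y \<in> PiE {0..<Suc 0} (\<lambda>_. A)" using a by auto
      have "emeasure PF.lim (prefixed A [a]) = emeasure (C 0 (Suc 0) (\<lambda>_. undefined)) {?y}"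
        using emeasure_lim_prefixed(2)[OF, of "[a]"] a by simp
      also have "\<dots> = emeasure (P 0 (restrict ?y {0..<0})) {?y 0} *
          emeasure (C 0 0 (\<lambda>_. undefined)) {restrict ?y {0..<0}}"
        by (rule emeasure_C_singleton_Suc[OF y])
      also have "emeasure (C 0 0 (\<lambda>_. undefined)) {restrict ?y {0..<0}} = 1"
        by (simp add: restrict_def PiM_empty)
      finally show ?thesis
        using single[OF a, of q] P_def[of 0] by simp
    qed
    fix xs a b assume A: "set (xs @ [a, b]) \<subseteq> A"
    let ?n = "length xs" let ?y = "\<lambda>i\<in>{0..<Suc (Suc ?n)}. (xs @ [a, b]) ! i"
    have y: "?y \<in> PiE {0..<Suc (Suc ?n)} (\<lambda>_. A)"
      using A nth_mem[of _ "xs @ [a, b]"] by (auto simp del: nth_mem set_append)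
    have r: "restrict ?y {0..<Suc ?n} = (\<lambda>i\<in>{0..<Suc ?n}. (xs @ [a]) ! i)"
      by (auto simp: fun_eq_iff nth_append nth_Cons')
    have "emeasure PF.lim (prefixed A (xs @ [a, b])) =
        emeasure (C 0 (Suc (Suc ?n)) (\<lambda>_. undefined)) {?y}"
      using emeasure_lim_prefixed(2)[OF A] by simp
    also have "\<dots> = emeasure (P (Suc ?n) (restrict ?y {0..<Suc ?n})) {?y (Suc ?n)} *
        emeasure (C 0 (Suc ?n) (\<lambda>_. undefined)) {restrict ?y {0..<Suc ?n}}"
      by (rule emeasure_C_singleton_Suc[OF y])
    also have "emeasure (P (Suc ?n) (restrict ?y {0..<Suc ?n})) {?y (Suc ?n)} = k a b"
      using A single[of b "k a"] by (simp add: P_def nth_append)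
    also have "emeasure (C 0 (Suc ?n) (\<lambda>_. undefined)) {restrict ?y {0..<Suc ?n}} =
        emeasure PF.lim (prefixed A (xs @ [a]))"
      unfolding r using emeasure_lim_prefixed(2)[OF, of "xs @ [a]"] A by simp
    finally show "emeasure PF.lim (prefixed A (xs @ [a, b])) =
      k a b * emeasure PF.lim (prefixed A (xs @ [a]))" .
  qed
qed

section \<open>The measure of a harmonic vector\<close>

lemma weight_eq_0_if_not_arcs: "\<not> set xs \<subseteq> arcs G \<Longrightarrow> weight G F \<beta> f v xs = 0"
  by (induction xs arbitrary: v) auto

text \<open>
  The image of a geometric law under an enumeration of \<open>A\<close>.
\<close>

lemma ex_pmf_full_support:
  assumes "countable A" "A \<noteq> {}"
  shows "\<exists>p. set_pmf p = A"
proof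
  have "set_pmf (map_pmf (from_nat_into A) (geometric_pmf (1/2))) = from_nat_into A ` UNIV"
    by (simp add: set_pmf_geometric)
  then show "set_pmf (map_pmf (from_nat_into A) (geometric_pmf (1/2))) = A"
    using range_from_nat_into[OF assms(2,1)] by simp
qed

context countable_digraph
begin

text \<open>
  A sequence of arrows fails to be a path because of two consecutive arrows that do not fit. The union
  over the finite lists that end in such a pair is countable, so it is null as soon as each of its
  members is.
\<close>

lemma inf_paths_compl_eq_UN:
  "{\<omega>. range \<omega> \<subseteq> arcs G} - inf_paths G =
    (\<Union>(xs, a, b)\<in>{(xs, a, b). xs \<in> lists (arcs G) \<and> a \<in> arcs G \<and> b \<in> arcs G \<and> head G a \<noteq> tail G b}.
      prefixed (arcs G) (xs @ [a, b]))" (is "?L = (\<Union>(xs, a, b)\<in>?I. _)")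
proof (intro equalityI subsetI)
  fix \<omega> assume w: "\<omega> \<in> ?L"
  then have arcs: "\<omega> i \<in> arcs G" for i
    by blast
  have "\<not> (\<forall>i. head G (\<omega> i) = tail G (\<omega> (Suc i)))"
    using w arcs unfolding inf_paths_def by blast
  then obtain i where i: "head G (\<omega> i) \<noteq> tail G (\<omega> (Suc i))"
    by blast
  have "\<omega> j = (map \<omega> [0..<i] @ [\<omega> i, \<omega> (Suc i)]) ! j"
    if "j < length (map \<omega> [0..<i] @ [\<omega> i, \<omega> (Suc i)])" for j
  proof -
    have "j < Suc (Suc i)"
      using that by simp
    then consider "j < i" | "j = i" | "j = Suc i"
      by linarith
    then show ?thesis
      by cases (simp_all add: nth_append)
  qed
  then have "\<omega> \<in> prefixed (arcs G) (map \<omega> [0..<i] @ [\<omega> i, \<omega> (Suc i)])"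
    using arcs unfolding prefixed_def by blast
  moreover have "(map \<omega> [0..<i], \<omega> i, \<omega> (Suc i)) \<in> ?I"
    using arcs i by (simp add: image_subset_iff in_lists_conv_set)
  ultimately show "\<omega> \<in> (\<Union>(xs, a, b)\<in>?I. prefixed (arcs G) (xs @ [a, b]))"
    by (intro UN_I[of "(map \<omega> [0..<i], \<omega> i, \<omega> (Suc i))"]) simp_all
next
  fix \<omega> assume "\<omega> \<in> (\<Union>(xs, a, b)\<in>?I. prefixed (arcs G) (xs @ [a, b]))"
  then obtain z where z: "z \<in> ?I" "\<omega> \<in> (case z of (xs, a, b) \<Rightarrow> prefixed (arcs G) (xs @ [a, b]))"
    by (rule UN_E)
  obtain xs a b where "z = (xs, a, b)"
    by (cases z)
  then have ab: "head G a \<noteq> tail G b" and w: "\<omega> \<in> prefixed (arcs G) (xs @ [a, b])"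
    using z by simp_all
  have "\<omega> i = (xs @ [a, b]) ! i" if "i < length (xs @ [a, b])" for i
    using w that unfolding prefixed_def by blast
  from this[of "length xs"] this[of "Suc (length xs)"]
  have "\<omega> (length xs) = a" "\<omega> (Suc (length xs)) = b"
    by (simp_all add: nth_append)
  then have "\<omega> \<notin> inf_paths G"
    using ab unfolding inf_paths_def by blast
  then show "\<omega> \<in> ?L"
    using w by (simp add: prefixed_def)
qed

lemma cyl_eq_prefixed:
  assumes "a \<in> out_arcs G v"
  shows "cyl G v (a # xs) = inf_paths G \<inter> prefixed (arcs G) (a # xs)"
proof (intro equalityI subsetI)
  fix p assume p: "p \<in> cyl G v (a # xs)"
  then have P: "p \<in> inf_paths G"
    by (rule subsetD[OF cyl_subset])
  then show "p \<in> inf_paths G \<inter> prefixed (arcs G) (a # xs)"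
    using p inf_paths_arc[OF P] by (simp add: cyl_def prefixed_def image_subset_iff)
next
  fix p assume p: "p \<in> inf_paths G \<inter> prefixed (arcs G) (a # xs)"
  then have "p 0 = (a # xs) ! 0"
    unfolding prefixed_def by (simp del: nth_Cons_0)
  then show "p \<in> cyl G v (a # xs)"
    using p assms by (simp add: cyl_def prefixed_def vertex_cyl_def)
qed

lemma cyl_eq_empty_if_not_arcs:
  assumes "\<not> set xs \<subseteq> arcs G"
  shows "cyl G v xs = {}"
proof -
  obtain i where i: "i < length xs" "xs ! i \<notin> arcs G"
    using assms by (auto simp: set_conv_nth)
  have False if p: "p \<in> cyl G v xs" for p
  proof -
    have "p i = xs ! i"
      using p i(1) by (simp add: cyl_def)
    then show False
      using inf_paths_arc[OF subsetD[OF cyl_subset p], of i] i(2) by simp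
  qed
  then show ?thesis by blast
qed

text \<open>
  The existence half of the correspondence. The measure is the law of a Markov chain of arrows, reweighted
  by a density in the first arrow and restricted to the paths.
\<close>

lemma ex_measure_of_weights:
  assumes fin: "\<And>v. v \<in> verts G \<Longrightarrow> f v \<noteq> \<infinity>"
    and harmonic: "\<And>v. v \<in> verts G \<Longrightarrow>
      (\<integral>\<^sup>+a. ennreal (exp (- \<beta> * F a)) * f (head G a) \<partial>count_space (out_arcs G v)) = f v"
    and arcs: "arcs G \<noteq> {}"
  obtains m where "sets m = sets (path_borel G)"
    and "\<And>v xs. v \<in> verts G \<Longrightarrow> emeasure m (cyl G v xs) = weight G F \<beta> f v xs"
proof -
  let ?A = "arcs G" and ?e = "\<lambda>a. ennreal (exp (- \<beta> * F a))" and ?W = "weight G F \<beta> f"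
  obtain Q where Q: "set_pmf Q = ?A"
    using ex_pmf_full_support[OF countable_arcs arcs] by blast
  define q where "q a = ennreal (pmf Q a)" for a
  \<comment> \<open>At a vertex where \<open>f\<close> vanishes no transition probabilities are prescribed; staying at \<open>a\<close> completes the kernel there.\<close>
  define k where "k a b = (if f (head G a) = 0 then indicator {a} b
    else ?W (head G a) [b] / f (head G a))" for a b
  \<comment> \<open>If \<open>f\<close> vanishes at the range of \<open>a\<close>, harmonicity makes every term of the sum at that vertex vanish, so the equation holds with both sides zero.\<close>
  have k_weight: "k a b * f (head G a) = ?W (head G a) [b]" if "a \<in> ?A" for a b
  proof (cases "f (head G a) = 0")
    case True
    have "(\<integral>\<^sup>+a. ?e a * f (head G a) \<partial>count_space (out_arcs G (head G a))) = 0"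
      using harmonic[of "head G a"] that True by simp
    then have "AE b in count_space (out_arcs G (head G a)). ?e b * f (head G b) = 0"
      by (subst (asm) nn_integral_0_iff_AE) auto
    then have "\<forall>b\<in>out_arcs G (head G a). ?e b * f (head G b) = 0"
      by (simp only: AE_count_space)
    then show ?thesis
      using True by simp
  next
    case False
    have "f (head G a) < top"
      using fin that by (simp add: top.not_eq_extremum)
    then show ?thesis
      unfolding k_def using False
      by (simp only: if_False ennreal_divide_times ennreal_divide_self[OF False] mult_1_right)
  qed
  have k_sum: "(\<integral>\<^sup>+b. k a b \<partial>count_space ?A) = 1" if a: "a \<in> ?A" for a
  proof (cases "f (head G a) = 0")
    case True
    then show ?thesis
      using a by (simp add: k_def)
  next
    case False
    have head: "head G a \<in> verts G" using a by simp
    have "(\<integral>\<^sup>+b. k a b \<partial>count_space ?A) = (\<integral>\<^sup>+b. ?W (head G a) [b] \<partial>count_space ?A) / f (head G a)"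
      using False by (simp only: k_def if_False nn_integral_divide borel_measurable_count_space)
    also have "(\<integral>\<^sup>+b. ?W (head G a) [b] \<partial>count_space ?A) =
        (\<integral>\<^sup>+b. ?e b * f (head G b) \<partial>count_space (out_arcs G (head G a)))"
      by (auto simp: nn_integral_count_space_indicator intro!: nn_integral_cong split: split_indicator)
    also have "\<dots> = f (head G a)"
      by (rule harmonic[OF head])
    also have "f (head G a) / f (head G a) = 1"
      using False fin[OF head] by (simp add: ennreal_divide_self top.not_eq_extremum)
    finally show ?thesis .
  qed
  have q_sum: "(\<integral>\<^sup>+a. q a \<partial>count_space ?A) = 1"
    unfolding q_def nn_integral_pmf using Q measure_pmf.emeasure_eq_1_AE[of ?A Q]
    by (simp add: AE_measure_pmf_iff)
  obtain N where sets_N: "sets N = sets (PiM UNIV (\<lambda>_::nat. count_space ?A))"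
    and prefixed: "\<And>xs. set xs \<subseteq> ?A \<Longrightarrow> prefixed ?A xs \<in> sets N"
    and N_start: "\<And>a. a \<in> ?A \<Longrightarrow> emeasure N (prefixed ?A [a]) = q a"
    and N_step: "\<And>xs a b. set (xs @ [a, b]) \<subseteq> ?A \<Longrightarrow>
      emeasure N (prefixed ?A (xs @ [a, b])) = k a b * emeasure N (prefixed ?A (xs @ [a]))"
    using ex_markov_chain[where q = q and k = k and A = ?A, OF q_sum k_sum, where ?thesis = thesis]
    by blast
  have space_N: "space N = {\<omega>. range \<omega> \<subseteq> ?A}"
    using sets_eq_imp_space_eq[OF sets_N] by (auto simp: space_PiM PiE_iff)
  \<comment> \<open>The density replaces the arbitrary initial law \<open>q\<close> by the weights of the first arrow.\<close>
  define d where "d a = ?e a * f (head G a) / q a" for a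
  have d_q: "d a * q a = ?e a * f (head G a)" if "a \<in> ?A" for a
  proof -
    have "q a \<noteq> 0" "q a < top"
      using that Q by (auto simp: q_def set_pmf_iff)
    then have "q a / q a = 1"
      by (rule ennreal_divide_self)
    then show ?thesis
      unfolding d_def by (simp only: ennreal_divide_times mult_1_right)
  qed
  have d_meas: "(\<lambda>\<omega>. d (\<omega> 0)) \<in> borel_measurable N"
    unfolding measurable_cong_sets[OF sets_N refl]
    by (rule measurable_compose[OF measurable_component_singleton[of 0]]) simp_all
  define \<mu> where "\<mu> = density N (\<lambda>\<omega>. d (\<omega> 0))"
  have \<mu>_N: "emeasure \<mu> (prefixed ?A (a # xs)) = d a * emeasure N (prefixed ?A (a # xs))"
    if "set (a # xs) \<subseteq> ?A" for a xs
  proof -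
    have "emeasure \<mu> (prefixed ?A (a # xs)) = (\<integral>\<^sup>+\<omega>. d (\<omega> 0) * indicator (prefixed ?A (a # xs)) \<omega> \<partial>N)"
      unfolding \<mu>_def by (rule emeasure_density[OF d_meas prefixed[OF that]])
    also have "\<dots> = (\<integral>\<^sup>+\<omega>. d a * indicator (prefixed ?A (a # xs)) \<omega> \<partial>N)"
      by (rule nn_integral_cong) (auto simp: prefixed_def split: split_indicator)
    finally show ?thesis
      by (simp only: nn_integral_cmult_indicator[OF prefixed[OF that]])
  qed
  have \<mu>_snoc: "emeasure \<mu> (prefixed ?A (xs @ [a])) = ?W (tail G (hd (xs @ [a]))) (xs @ [a])"
    if "set (xs @ [a]) \<subseteq> ?A" for xs a
    using that
  proof (induction xs arbitrary: a rule: rev_induct)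
    case Nil
    then show ?case
      using \<mu>_N[of a "[]"] d_q[of a] N_start[of a] by simp
  next
    case (snoc b xs)
    have A: "set (xs @ [b]) \<subseteq> ?A" "set (xs @ [b, a]) \<subseteq> ?A" "b \<in> ?A"
      using snoc.prems by auto
    obtain c ys where c: "xs @ [b] = c # ys" "xs @ [b, a] = c # (ys @ [a])"
      by (cases xs) auto
    have "emeasure \<mu> (prefixed ?A (xs @ [b, a])) = k b a * emeasure \<mu> (prefixed ?A (xs @ [b]))"
      using \<mu>_N[of c "ys"] \<mu>_N[of c "ys @ [a]"] N_step[OF A(2)] A(1,2)
      unfolding c by (simp only: mult_ac)
    also have "\<dots> = k b a * ?W (tail G c) (xs @ [b])"
      using snoc.IH[OF A(1)] c(1) by simp
    also have "\<dots> = ?W (tail G c) (xs @ [b, a])"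
      using weight_snoc[of "k b a" f G b F \<beta> a, OF k_weight[OF A(3)]] by simp
    finally show ?case
      using c by simp
  qed
  have \<mu>_Cons: "emeasure \<mu> (prefixed ?A (a # xs)) = ?W (tail G a) (a # xs)"
    if "set (a # xs) \<subseteq> ?A" for a xs
    using \<mu>_snoc[of "butlast (a # xs)" "last (a # xs)"] that
    by (simp only: append_butlast_last_id list.distinct list.sel not_False_eq_True)
  define I where "I = {(xs, a, b). xs \<in> lists ?A \<and> a \<in> ?A \<and> b \<in> ?A \<and> head G a \<noteq> tail G b}"
  have "countable I"
    by (rule countable_subset[of _ "lists ?A \<times> ?A \<times> ?A"])
      (auto simp: I_def intro!: countable_SIGMA countable_lists countable_arcs)
  moreover have "prefixed ?A (xs @ [a, b]) \<in> null_sets \<mu>" if "(xs, a, b) \<in> I" for xs a b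
  proof -
    have A: "set (xs @ [a, b]) \<subseteq> ?A" and ab: "head G a \<noteq> tail G b"
      using that by (auto simp: I_def)
    \<comment> \<open>A pair that does not fit behaves like a transition of probability zero.\<close>
    have "0 * f (head G a) = ?W (head G a) [b]"
      using ab by simp
    from weight_snoc[OF this] have "?W v (xs @ [a, b]) = 0" for v
      by simp
    then have "emeasure \<mu> (prefixed ?A (xs @ [a, b])) = 0"
      using \<mu>_snoc[of "xs @ [a]" b] A by simp
    then show ?thesis
      using prefixed[OF A] by (simp add: null_sets_def \<mu>_def)
  qed
  ultimately have "(\<Union>(xs, a, b)\<in>I. prefixed ?A (xs @ [a, b])) \<in> null_sets \<mu>"
    by (intro null_sets_UN') auto
  then have null: "space N - inf_paths G \<in> null_sets \<mu>"
    unfolding space_N inf_paths_compl_eq_UN I_def .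
  have P_eq: "inf_paths G = space N - (space N - inf_paths G)"
    using inf_paths_arc unfolding space_N by blast
  have P_sets: "inf_paths G \<in> sets \<mu>"
    using null_setsD2[OF null] sets.compl_sets[of "space N - inf_paths G" \<mu>] P_eq by (simp add: \<mu>_def)
  have cyl_Cons_sets: "cyl G v (a # xs) \<in> sets \<mu>"
    and cyl_Cons_weight: "emeasure \<mu> (cyl G v (a # xs)) = ?W v (a # xs)" for v a xs
  proof -
    have "cyl G v (a # xs) \<in> sets \<mu> \<and> emeasure \<mu> (cyl G v (a # xs)) = ?W v (a # xs)"
    proof (cases "a \<in> out_arcs G v \<and> set xs \<subseteq> ?A")
      case True
      then have a: "a \<in> out_arcs G v" "set (a # xs) \<subseteq> ?A" "tail G a = v"
        by auto
      have X: "prefixed ?A (a # xs) \<in> sets \<mu>"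
        using prefixed[OF a(2)] by (simp add: \<mu>_def)
      have "cyl G v (a # xs) = prefixed ?A (a # xs) - (space N - inf_paths G)"
        unfolding cyl_eq_prefixed[OF a(1)] using sets.sets_into_space[OF prefixed[OF a(2)]] by blast
      then have "emeasure \<mu> (cyl G v (a # xs)) = emeasure \<mu> (prefixed ?A (a # xs))"
        using emeasure_Diff_null_set[OF null X] by simp
      then show ?thesis
        unfolding \<mu>_Cons[OF a(2)] a(3) using sets.Int[OF P_sets X] cyl_eq_prefixed[OF a(1)] by simp
    next
      case False
      have "cyl G v (a # xs) = {} \<and> ?W v (a # xs) = 0"
      proof (cases "a \<in> out_arcs G v")
        case True
        then have "\<not> set (a # xs) \<subseteq> ?A"
          using False by auto
        then show ?thesis
          by (intro conjI cyl_eq_empty_if_not_arcs weight_eq_0_if_not_arcs)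
      next
        case False
        then show ?thesis
          by (simp only: cyl_Cons_not_out_arc[OF False] weight.simps if_False)
      qed
      then show ?thesis
        by (simp only: sets.empty_sets emeasure_empty)
    qed
    then show "cyl G v (a # xs) \<in> sets \<mu>" "emeasure \<mu> (cyl G v (a # xs)) = ?W v (a # xs)"
      by auto
  qed
  have cyl_sets: "cyl G v xs \<in> sets \<mu>" for v xs
  proof (cases xs)
    case Nil
    have "(\<Union>a\<in>out_arcs G v. cyl G v [a]) \<in> sets \<mu>"
      using cyl_Cons_sets countable_out_arcs by (intro sets.countable_UN') blast+
    then show ?thesis
      unfolding Nil cyl_Nil by (simp only: vertex_cyl_eq_UN[symmetric])
  qed (simp add: cyl_Cons_sets)
  have P_space: "space (restrict_space \<mu> (inf_paths G)) = inf_paths G"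
    using sets.sets_into_space[OF P_sets] by (simp add: space_restrict_space Int_absorb2)
  have id: "(\<lambda>p. p) \<in> restrict_space \<mu> (inf_paths G) \<rightarrow>\<^sub>M path_borel G"
  proof (rule measurable_into_path_borel)
    show "(\<lambda>p. p) \<in> space (restrict_space \<mu> (inf_paths G)) \<rightarrow> inf_paths G"
      unfolding P_space by simp
    show "(\<lambda>p. p) -` cyl G v xs \<inter> space (restrict_space \<mu> (inf_paths G))
        \<in> sets (restrict_space \<mu> (inf_paths G))" for v xs
      unfolding P_space using cyl_sets[of v xs] cyl_subset[of G v xs] P_sets
      by (subst sets_restrict_space_iff) (simp_all add: Int_absorb2)
  qed
  define m where "m = distr (restrict_space \<mu> (inf_paths G)) (path_borel G) (\<lambda>p. p)"
  have sets_m: "sets m = sets (path_borel G)"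
    by (simp add: m_def)
  have m_\<mu>: "emeasure m (cyl G v xs) = emeasure \<mu> (cyl G v xs)" for v xs
  proof -
    have "emeasure m (cyl G v xs) = emeasure (restrict_space \<mu> (inf_paths G)) (cyl G v xs)"
      unfolding m_def using cyl_subset[of G v xs]
      by (subst emeasure_distr[OF id cyl_in_path_borel]) (simp add: P_space Int_absorb2)
    also have "\<dots> = emeasure \<mu> (cyl G v xs)"
      using P_sets cyl_subset[of G v xs] by (intro emeasure_restrict_space) (simp_all add: sets.Int_space_eq2)
    finally show ?thesis .
  qed
  have "emeasure m (cyl G v xs) = ?W v xs" if v: "v \<in> verts G" for v xs
  proof (cases xs)
    case Nil
    have "emeasure m (vertex_cyl G v) = (\<integral>\<^sup>+a. ?W v [a] \<partial>count_space (out_arcs G v))"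
      unfolding emeasure_vertex_cyl[OF sets_m] m_\<mu> cyl_Cons_weight ..
    also have "\<dots> = (\<integral>\<^sup>+a. ?e a * f (head G a) \<partial>count_space (out_arcs G v))"
      by (rule nn_integral_cong) simp
    finally show ?thesis
      using harmonic[OF v] by (simp add: Nil)
  next
    case (Cons a ys)
    then show ?thesis
      using m_\<mu> cyl_Cons_weight by (simp only:)
  qed
  with sets_m show thesis
    by (rule that)
qed

lemma conformal_measure_emeasure_vertex_cyl:
  assumes "conformal_measure G F \<beta> m" "v \<in> verts G"
  shows "emeasure m (vertex_cyl G v) = ennreal (measure m (vertex_cyl G v))"
  using assms by (intro emeasure_eq_ennreal_measure) (auto simp: conformal_measure_def)

text \<open>
  Additivity over the first arrow gives the harmonicity equation. The vector is nonzero because otherwise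
  the path space would be a countable union of null sets \<open>Z(v)\<close>.
\<close>

lemma conformal_measure_imp_harmonic:
  assumes m: "conformal_measure G F \<beta> m"
  shows "harmonic_vector G F \<beta> (\<lambda>v\<in>verts G. measure m (vertex_cyl G v))"
proof -
  let ?\<psi> = "\<lambda>v\<in>verts G. measure m (vertex_cyl G v)"
  have sets: "sets m = sets (path_borel G)" and nz: "emeasure m (inf_paths G) \<noteq> 0"
    using m unfolding conformal_measure_def by blast+
  have \<psi>: "ennreal (?\<psi> v) = emeasure m (vertex_cyl G v)" if "v \<in> verts G" for v
    using conformal_measure_emeasure_vertex_cyl[OF m that] that by simp
  have "\<exists>v\<in>verts G. ?\<psi> v \<noteq> 0"
  proof (rule ccontr)
    assume "\<not> (\<exists>v\<in>verts G. ?\<psi> v \<noteq> 0)"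
    then have "vertex_cyl G v \<in> null_sets m" if "v \<in> verts G" for v
      using \<psi>[OF that] that sets by (simp add: null_sets_def)
    then have "(\<Union>v\<in>verts G. vertex_cyl G v) \<in> null_sets m"
      by (rule null_sets_UN'[OF countable_verts])
    then show False
      using nz unfolding inf_paths_eq_UN[symmetric] by auto
  qed
  moreover have "(\<Sum>\<^sub>\<infinity>w\<in>verts G. adj_matrix G F \<beta> v w * ennreal (?\<psi> w)) = ennreal (?\<psi> v)"
    if v: "v \<in> verts G" for v
  proof -
    have "(\<Sum>\<^sub>\<infinity>w\<in>verts G. adj_matrix G F \<beta> v w * ennreal (?\<psi> w)) =
        (\<integral>\<^sup>+a. ennreal (exp (- \<beta> * F a)) * ennreal (?\<psi> (head G a)) \<partial>count_space (out_arcs G v))"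
      by (rule harmonic_sum_eq[OF v])
    also have "\<dots> = (\<integral>\<^sup>+a. emeasure m (cyl G v [a]) \<partial>count_space (out_arcs G v))"
    proof (rule nn_integral_cong)
      fix a assume "a \<in> space (count_space (out_arcs G v))"
      then have "a \<in> out_arcs G v" "head G a \<in> verts G"
        by auto
      then show "ennreal (exp (- \<beta> * F a)) * ennreal (?\<psi> (head G a)) = emeasure m (cyl G v [a])"
        by (simp only: \<psi> conformal_measure_cyl[OF m, of v "[a]"] weight.simps if_True)
    qed
    also have "\<dots> = ennreal (?\<psi> v)"
      unfolding \<psi>[OF v] by (rule emeasure_vertex_cyl[OF sets, symmetric])
    finally show ?thesis .
  qed
  moreover have "?\<psi> \<in> verts G \<rightarrow>\<^sub>E {0..}"
    by auto
  ultimately show ?thesis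
    unfolding harmonic_vector_def by blast
qed

lemma conformal_measure_eqI:
  assumes m: "conformal_measure G F \<beta> m" and m': "conformal_measure G F \<beta> m'"
    and eq: "\<And>v. v \<in> verts G \<Longrightarrow> measure m (vertex_cyl G v) = measure m' (vertex_cyl G v)"
  shows "m = m'"
proof (rule measure_eqI_cyl)
  show "sets m = sets (path_borel G)" "sets m' = sets (path_borel G)"
    using m m' unfolding conformal_measure_def by blast+
  show "emeasure m (vertex_cyl G v) \<noteq> \<infinity>" if "v \<in> verts G" for v
    using conformal_measure_emeasure_vertex_cyl[OF m that] by simp
  show "emeasure m (cyl G v xs) = emeasure m' (cyl G v xs)" if v: "v \<in> verts G" for v xs
  proof -
    have "emeasure m (vertex_cyl G w) = emeasure m' (vertex_cyl G w)" if "w \<in> verts G" for w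
      using eq[OF that] conformal_measure_emeasure_vertex_cyl[OF m that]
        conformal_measure_emeasure_vertex_cyl[OF m' that] by simp
    then show ?thesis
      unfolding conformal_measure_cyl[OF m] conformal_measure_cyl[OF m']
      by (rule weight_cong[OF wf_digraph_axioms _ v])
  qed
qed

lemma harmonic_imp_ex_conformal_measure:
  assumes \<psi>: "harmonic_vector G F \<beta> \<psi>"
  shows "\<exists>m. conformal_measure G F \<beta> m \<and> (\<lambda>v\<in>verts G. measure m (vertex_cyl G v)) = \<psi>"
proof -
  have ext: "\<psi> \<in> verts G \<rightarrow>\<^sub>E {0..}"
    using \<psi> unfolding harmonic_vector_def by blast
  obtain v0 where v0: "v0 \<in> verts G" "\<psi> v0 \<noteq> 0"
    using \<psi> unfolding harmonic_vector_def by blast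
  have nonneg: "0 \<le> \<psi> v" if "v \<in> verts G" for v
    using ext that by auto
  have harm: "(\<integral>\<^sup>+a. ennreal (exp (- \<beta> * F a)) * ennreal (\<psi> (head G a)) \<partial>count_space (out_arcs G v)) =
      ennreal (\<psi> v)" if "v \<in> verts G" for v
    using \<psi> that harmonic_sum_eq[OF that, of F \<beta> "\<lambda>w. ennreal (\<psi> w)"]
    unfolding harmonic_vector_def by simp
  have "arcs G \<noteq> {}"
  proof
    assume "arcs G = {}"
    then have "out_arcs G v0 = {}" by auto
    then show False
      using harm[OF v0(1)] v0 nonneg[OF v0(1)] by (simp add: nn_integral_empty)
  qed
  then obtain m where sets: "sets m = sets (path_borel G)"
    and cyl: "\<And>v xs. v \<in> verts G \<Longrightarrow> emeasure m (cyl G v xs) = weight G F \<beta> (\<lambda>w. ennreal (\<psi> w)) v xs"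
    using ex_measure_of_weights[of "\<lambda>w. ennreal (\<psi> w)" \<beta> F, OF _ harm] by auto
  have Z: "emeasure m (vertex_cyl G v) = ennreal (\<psi> v)" if "v \<in> verts G" for v
    using cyl[OF that, of "[]"] by simp
  have "conformal_measure G F \<beta> m"
    unfolding conformal_measure_def
  proof (intro conjI ballI)
    show "emeasure m (inf_paths G) \<noteq> 0"
    proof
      assume "emeasure m (inf_paths G) = 0"
      moreover have "emeasure m (vertex_cyl G v0) \<le> emeasure m (inf_paths G)"
        using sets sets.top[of "path_borel G"] unfolding space_path_borel
        by (intro emeasure_mono) (auto simp: vertex_cyl_def)
      ultimately show False
        using Z[OF v0(1)] v0 nonneg[OF v0(1)] by simp
    qed
    show "emeasure m (vertex_cyl G v) < \<infinity>" if "v \<in> verts G" for v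
      using Z[OF that] by simp
    show "emeasure m (path_shift ` (B \<inter> arrow_cyl G a)) =
        ennreal (exp (\<beta> * F a)) * emeasure m (B \<inter> arrow_cyl G a)"
      if "a \<in> arcs G" "B \<in> sets (path_borel G)" for a B
      using Z by (intro conformal_scaling_of_cyl[OF sets _ cyl that]) simp_all
  qed (rule sets)
  moreover have "(\<lambda>v\<in>verts G. measure m (vertex_cyl G v)) = \<psi>"
  proof
    fix v
    show "(\<lambda>v\<in>verts G. measure m (vertex_cyl G v)) v = \<psi> v"
    proof (cases "v \<in> verts G")
      case True
      then show ?thesis
        using Z[OF True] nonneg[OF True] by (simp add: measure_def)
    next
      case False
      then show ?thesis
        using PiE_arb[OF ext False] by simp
    qed
  qed
  ultimately show ?thesis by blast
qed

end

theorem proposition3p4: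
  fixes G :: "('v, 'a) pre_digraph" and F :: "'a \<Rightarrow> real" and \<beta> :: real
  assumes "wf_digraph G" and "countable (verts G)" and "countable (arcs G)"
  shows "bij_betw (\<lambda>m. \<lambda>v\<in>verts G. measure m (vertex_cyl G v))
           {m. conformal_measure G F \<beta> m} {\<psi>. harmonic_vector G F \<beta> \<psi>}"
proof -
  interpret countable_digraph G
    using assms by (simp add: countable_digraph_def countable_digraph_axioms_def)
  show ?thesis
    unfolding bij_betw_def
  proof (intro conjI equalityI subsetI)
    show "inj_on (\<lambda>m. \<lambda>v\<in>verts G. measure m (vertex_cyl G v)) {m. conformal_measure G F \<beta> m}"
    proof (rule inj_onI)
      fix m m'
      assume m: "m \<in> {m. conformal_measure G F \<beta> m}" and m': "m' \<in> {m. conformal_measure G F \<beta> m}"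
        and eq: "(\<lambda>v\<in>verts G. measure m (vertex_cyl G v)) = (\<lambda>v\<in>verts G. measure m' (vertex_cyl G v))"
      have "measure m (vertex_cyl G v) = measure m' (vertex_cyl G v)" if "v \<in> verts G" for v
        using fun_cong[OF eq, of v] that by simp
      with m m' show "m = m'"
        using conformal_measure_eqI by simp
    qed
  next
    fix \<psi> assume "\<psi> \<in> (\<lambda>m. \<lambda>v\<in>verts G. measure m (vertex_cyl G v)) ` {m. conformal_measure G F \<beta> m}"
    then show "\<psi> \<in> {\<psi>. harmonic_vector G F \<beta> \<psi>}"
      using conformal_measure_imp_harmonic by blast
  next
    fix \<psi> assume "\<psi> \<in> {\<psi>. harmonic_vector G F \<beta> \<psi>}"
    then show "\<psi> \<in> (\<lambda>m. \<lambda>v\<in>verts G. measure m (vertex_cyl G v)) ` {m. conformal_measure G F \<beta> m}"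
      using harmonic_imp_ex_conformal_measure by blast
  qed
qed

end
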